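(* Let the parameters of the Gaussian distribution $\mathcal{N}(\bar{\boldsymbol{\mu}}_t,\bar\Sigma_t)$ on $\mathbb{R}^n$ evolve according to $$\frac{d\bar{\boldsymbol{\mu}}_t}{dt}=-\bar\Sigma_t\,\mathbb{E}_{\mathbf{x}\sim\mathcal{N}(\bar{\boldsymbol{\mu}}_t,\bar\Sigma_t)}[\nabla_{\mathbf{x}}V(\mathbf{x})],\qquad \frac{d\bar\Sigma_t^{-1}}{dt}=\mathbb{E}_{\mathbf{x}\sim\mathcal{N}(\bar{\boldsymbol{\mu}}_t,\bar\Sigma_t)}[\nabla^2_{\mathbf{x}}V(\mathbf{x})].$$ Let $\mathbf{x}_0$ be a Gauss-Hermite particle corresponding to $\mathcal{N}(\bar{\boldsymbol{\mu}}_{t=0},\bar\Sigma_{t=0})$, and let it evolve according to $\frac{d\mathbf{x}_t}{dt}=\bar A_t\mathbf{x}_t+\bar{\mathbf{b}}_t$, where $$\bar A_t=-\tfrac12\bar\Sigma_t\,\mathbb{E}_{\mathbf{x}\sim\mathcal{N}(\bar{\boldsymbol{\mu}}_t,\bar\Sigma_t)}[\nabla^2_{\mathbf{x}}V(\mathbf{x})],\qquad \bar{\mathbf{b}}_t=-\bar\Sigma_t\,\mathbb{E}_{\mathbf{x}\sim\mathcal{N}(\bar{\boldsymbol{\mu}}_t,\bar\Sigma_t)}[\nabla_{\mathbf{x}}V(\mathbf{x})]-\bar A_t\bar{\boldsymbol{\mu}}_t.$$ Then $\mathbf{x}_t$ is a Gauss-Hermite particle corresponding to $\mathcal{N}(\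bar{\boldsymbol{\mu}}_t,\bar\Sigma_t)$.
   Context: Gauss-Hermite particles: fix an order $p\ge1$ and let $\xi_1,\dots,\xi_p$ be the roots of the Hermite polynomial $h_p(\xi)=(-1)^p\exp(\xi^2/2)\frac{d^p}{d\xi^p}\exp(-\xi^2/2)$. The Gauss-Hermite particles corresponding to $\mathcal{N}(\mathbf{0},I)$ on $\mathbb{R}^n$ are the $p^n$ points $\boldsymbol{\xi}_i$ of the Cartesian product $\{\xi_1,\dots,\xi_p\}^n$. A Gauss-Hermite particle corresponding to $\mathcal{N}(\boldsymbol{\mu},\Sigma)$ is a point of the form $\mathbf{x}=L\boldsymbol{\xi}_i+\boldsymbol{\mu}$, where $L\in\mathbb{R}^{n\times n}$ is a matrix square root of $\Sigma$, meaning $LL^{\top}=\Sigma$ (such $L$ is not unique), and $\boldsymbol{\xi}_i$ is a Gauss-Hermite particle corresponding to $\mathcal{N}(\mathbf{0},I)$. The order $p$ is the same throughout. $V(\mathbf{x})=\log q(\mathbf{x})-\log p(\mathbf{x},\mathbf{z})$, where $p(\mathbf{x},\mathbf{z})=p(\mathbf{z}|\mathbf{x})p(\mathbf{x})$ is a joint density with $\mathbf{z}$ fixed and $q$ is the variational density at time $t$ (the Gaussian $\mathcal{N}(\bar{\boldsymbol{\mu}}_t,\bar\Sigma_t)$ itself, or a Gaussian mixture of which it is a component), so $V$ may depend on $t$; this dependence is suppressed in the notation. It is implicit that $V$ is twice continuously differentiable in $\mathbf{x}$, the expectations are finite and continuous in $t$, and $\bar\Sigma_t$ is symmetric positive definite,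 on the time interval where the flows are considered. *)

theory Defs
  imports "HOL-Probability.Probability"
begin

definition hermite :: "nat \<Rightarrow> real \<Rightarrow> real" where
  "hermite p x = (-1) ^ p * exp (x\<^sup>2 / 2) * (deriv ^^ p) (\<lambda>u. exp (- (u\<^sup>2) / 2)) x"

definition std_gauss_hermite_particles :: "nat \<Rightarrow> (real ^ 'n) set" where
  "std_gauss_hermite_particles p = {\<xi>. \<forall>i. \<xi> $ i \<in> {r. hermite p r = 0}}"

definition gauss_hermite_particle ::
  "nat \<Rightarrow> real ^ 'n \<Rightarrow> real ^ 'n ^ 'n \<Rightarrow> real ^ 'n \<Rightarrow> bool" where
  "gauss_hermite_particle p \<mu> \<Sigma> x \<longleftrightarrow>
     (\<exists>(L :: real ^ 'n ^ 'n) \<xi>. L ** transpose L = \<Sigma> \<and> \<xi> \<in> std_gauss_hermite_particles p \<and> x = L *v \<xi> + \<mu>)"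

definition spd :: "real ^ 'n ^ 'n \<Rightarrow> bool" where
  "spd S \<longleftrightarrow> transpose S = S \<and> (\<forall>x. x \<noteq> 0 \<longrightarrow> 0 < x \<bullet> (S *v x))"

definition gaussian_density :: "real ^ 'n \<Rightarrow> real ^ 'n ^ 'n \<Rightarrow> real ^ 'n \<Rightarrow> real" where
  "gaussian_density \<mu> \<Sigma> x =
     exp (- ((x - \<mu>) \<bullet> (matrix_inv \<Sigma> *v (x - \<mu>))) / 2) / sqrt ((2 * pi) ^ CARD('n) * det \<Sigma>)"

definition gaussian :: "real ^ 'n \<Rightarrow> real ^ 'n ^ 'n \<Rightarrow> (real ^ 'n) measure" where
  "gaussian \<mu> \<Sigma> = density lborel (\<lambda>x. ennreal (gaussian_density \<mu> \<Sigma> x))"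

text \<open>The Gaussian density itself is the case of a single component (\<open>k = 1\<close>).\<close>

definition gaussian_mixture_with_component ::
  "real ^ 'n \<Rightarrow> real ^ 'n ^ 'n \<Rightarrow> (real ^ 'n \<Rightarrow> real) \<Rightarrow> bool" where
  "gaussian_mixture_with_component \<mu> \<Sigma> q \<longleftrightarrow>
     (\<exists>(k::nat) w m S j.
        (\<forall>i<k. 0 \<le> w i \<and> spd (S i)) \<and> (\<Sum>i<k. w i) = 1 \<and>
        j < k \<and> 0 < w j \<and> m j = \<mu> \<and> S j = \<Sigma> \<and>
        q = (\<lambda>x. \<Sum>i<k. w i * gaussian_density (m i) (S i) x))"

definition probability_density :: "'a measure \<Rightarrow> ('a \<Rightarrow> real) \<Rightarrow> bool" where
  "probability_density M f \<longleftrightarrow>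
     f \<in> borel_measurable M \<and> (\<forall>x\<in>space M. 0 \<le> f x) \<and> (\<integral>\<^sup>+ x. ennreal (f x) \<partial>M) = 1"

definition gradient :: "(real ^ 'n \<Rightarrow> real) \<Rightarrow> real ^ 'n \<Rightarrow> real ^ 'n" where
  "gradient f x = (\<chi> i. frechet_derivative f (at x) (axis i 1))"

definition hessian :: "(real ^ 'n \<Rightarrow> real) \<Rightarrow> real ^ 'n \<Rightarrow> real ^ 'n ^ 'n" where
  "hessian f x = jacobian (gradient f) (at x)"

definition twice_continuously_differentiable :: "(real ^ 'n \<Rightarrow> real) \<Rightarrow> bool" where
  "twice_continuously_differentiable f \<longleftrightarrow>
     (\<forall>x. f differentiable at x) \<and> (\<forall>x. gradient f differentiable at x) \<and>
     continuous_on UNIV (hessian f)"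

end

theory Submission
  imports Defs
begin

text \<open>
  The centred particle \<open>Y = X - \<mu>\<close> solves \<open>Y' = A Y\<close>, and for \<open>P = matrix_inv \<Sigma>\<close> the choice
  of \<open>A\<close> makes the Mahalanobis norm \<open>Y \<bullet> P Y\<close> constant in time. If \<open>S S\<^sup>T = \<Sigma> t\<close> and
  \<open>X 0 = L \<xi> + \<mu> 0\<close>, then \<open>S\<inverse> (Y t)\<close> therefore has the same Euclidean norm as \<open>\<xi>\<close>, so
  some orthogonal \<open>Q\<close> carries \<open>\<xi>\<close> to it, and \<open>S Q\<close> is a square root of \<open>\<Sigma> t\<close> mapping the
  same \<open>\<xi>\<close> to \<open>Y t\<close>. Since only some square root is asked for, the matrix equation \<open>L' = A L\<close>
  need not be solved.
\<close>

lemma matrix_inv_cancel: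
  fixes S :: "real ^ 'n ^ 'n"
  assumes "invertible S"
  shows "S ** matrix_inv S = mat 1" "matrix_inv S ** S = mat 1"
  using someI_ex[OF assms[unfolded invertible_def]] by (auto simp: matrix_inv_def)

lemma matrix_inv_eqI:
  fixes S B :: "real ^ 'n ^ 'n"
  assumes "S ** B = mat 1"
  shows "matrix_inv S = B"
proof -
  have "invertible S"
    using assms invertible_right_inverse by blast
  then show ?thesis
    by (metis assms matrix_inv_cancel(2) matrix_mul_assoc matrix_mul_lid matrix_mul_rid)
qed

lemma inner_matrix_vector_transpose:
  fixes M :: "real ^ 'n ^ 'n"
  shows "(M *v x) \<bullet> y = x \<bullet> (transpose M *v y)"
  by (metis dot_lmul_matrix transpose_matrix_vector transpose_transpose)

lemma spd_invertible:
  assumes "spd S"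
  shows "invertible S"
proof -
  have "x = 0" if "S *v x = 0" for x
    using assms that unfolding spd_def by (metis inner_zero_right less_irrefl)
  then show ?thesis
    using invertible_left_inverse matrix_left_invertible_ker by blast
qed

lemma spd_matrix_inv:
  assumes "spd S"
  shows "spd (matrix_inv S)"
proof -
  let ?P = "matrix_inv S"
  note inv = matrix_inv_cancel[OF spd_invertible[OF assms]]
  have sym: "transpose S = S"
    using assms by (simp add: spd_def)
  have "S ** transpose ?P = mat 1"
    by (metis inv(2) matrix_transpose_mul sym transpose_mat)
  then have "transpose ?P = ?P"
    using matrix_inv_eqI by metis
  moreover have "0 < x \<bullet> (?P *v x)" if "x \<noteq> 0" for x
  proof -
    have x: "S *v (?P *v x) = x"
      by (simp add: matrix_vector_mul_assoc inv)
    then have "?P *v x \<noteq> 0"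
      using that by (metis matrix_vector_mult_0_right)
    \<comment> \<open>As \<open>x\<close> is the image of \<open>?P *v x\<close> under
      \<open>S\<close>, the quadratic form of \<open>?P\<close> at \<open>x\<close> is that of
      \<open>S\<close> at \<open>?P *v x\<close>.\<close>
    then have "0 < (?P *v x) \<bullet> (S *v (?P *v x))"
      using assms unfolding spd_def by blast
    then show ?thesis
      by (simp add: x inner_commute)
  qed
  ultimately show ?thesis
    by (simp add: spd_def)
qed

text \<open>Gram--Schmidt for the inner product \<open>x \<bullet> P y\<close>, indexed by subsets of the coordinate type.\<close>

lemma spd_orthonormal_family:
  fixes P :: "real ^ 'n ^ 'n" and F :: "'n set"
  assumes "spd P"
  shows "\<exists>v. \<forall>i\<in>F. \<forall>j\<in>F. v i \<bullet> (P *v v j) = (if i = j then 1 else 0)"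
proof -
  have "finite F"
    by simp
  then show ?thesis
  proof (induction F rule: finite_induct)
    case empty
    show ?case
      by simp
  next
    case (insert k F)
    then obtain v where v: "\<And>i j. i \<in> F \<Longrightarrow> j \<in> F \<Longrightarrow> v i \<bullet> (P *v v j) = (if i = j then 1 else 0)"
      by blast
    let ?W = "(\<lambda>j. P *v v j) ` F"
    \<comment> \<open>Instead of subtracting projections, count dimensions: fewer than
      \<open>CARD('n)\<close> vectors \<open>P *v v j\<close> lie in a hyperplane, and its normal
      \<open>a\<close> is orthogonal to every \<open>v j\<close> in the inner product of
      \<open>P\<close>.\<close>
    have "card F < CARD('n)"
      using insert.hyps by (intro psubset_card_mono) auto
    then have "dim ?W < DIM(real ^ 'n)"
      using dim_le_card'[of ?W] card_image_le[of F "\<lambda>j. P *v v j"] by simp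
    then obtain a where "a \<noteq> 0" and a: "\<And>j. j \<in> F \<Longrightarrow> a \<bullet> (P *v v j) = 0"
      using lowdim_subset_hyperplane[of ?W] span_superset[of ?W] by blast
    define c where "c = a \<bullet> (P *v a)"
    have "0 < c"
      using assms \<open>a \<noteq> 0\<close> by (simp add: spd_def c_def)
    have a': "v j \<bullet> (P *v a) = 0" if "j \<in> F" for j
      using a[OF that] assms inner_matrix_vector_transpose[of P "v j" a]
      by (simp add: spd_def inner_commute)
    \<comment> \<open>The new vector is \<open>a\<close> scaled to length 1 in the inner product of
      \<open>P\<close>.\<close>
    define u where "u = v(k := (1 / sqrt c) *\<^sub>R a)"
    have "u i \<bullet> (P *v u j) = (if i = j then 1 else 0)" if "i \<in> insert k F" "j \<in> insert k F" for i j
      using that v a a' \<open>0 < c\<close> insert.hyps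
      by (auto simp: u_def matrix_vector_mult_scaleR simp flip: c_def)
    then show ?case
      by blast
  qed
qed

text \<open>Let the rows of \<open>R\<close> be orthonormal for the inner product of
  \<open>?P\<close>, the inverse of \<open>S\<close>. This says
  \<open>R ** ?P ** transpose R = mat 1\<close>; solving for the inverse of \<open>?P\<close> gives
  \<open>S = transpose R ** R\<close>, so \<open>transpose R\<close> is a square root. No
  diagonalisation is involved.\<close>

lemma spd_square_root_exists:
  fixes S :: "real ^ 'n ^ 'n"
  assumes "spd S"
  obtains L :: "real ^ 'n ^ 'n" where "L ** transpose L = S"
proof -
  let ?P = "matrix_inv S"
  obtain v :: "'n \<Rightarrow> real ^ 'n"
    where v: "\<And>i j. v i \<bullet> (?P *v v j) = (if i = j then 1 else 0)"
    using spd_orthonormal_family[OF spd_matrix_inv[OF assms], of UNIV] by auto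
  define R :: "real ^ 'n ^ 'n" where "R = (\<chi> i. v i)"
  have "(R ** (?P ** transpose R)) $ i $ j = v i \<bullet> (?P *v v j)" for i j
    by (simp add: R_def matrix_matrix_mult_def matrix_vector_mult_def inner_vec_def transpose_def)
  then have "R ** (?P ** transpose R) = mat 1"
    by (simp add: vec_eq_iff v mat_def)
  \<comment> \<open>A one-sided inverse of a square matrix is two-sided, so \<open>R\<close> may
    move to the other end of the product.\<close>
  then have "?P ** (transpose R ** R) = mat 1"
    by (metis matrix_left_right_inverse matrix_mul_assoc)
  then have "matrix_inv ?P = transpose R ** R"
    by (rule matrix_inv_eqI)
  moreover have "matrix_inv ?P = S"
    by (rule matrix_inv_eqI) (rule matrix_inv_cancel[OF spd_invertible[OF assms]])
  ultimately show ?thesis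
    using that[of "transpose R"] by simp
qed

text \<open>From \<open>L ** transpose L = S\<close> the matrix
  \<open>transpose L ** matrix_inv S\<close> is a right inverse of the square matrix
  \<open>L\<close>, hence also a left inverse; so \<open>L\<close> is an isometry from the Euclidean
  norm to the Mahalanobis norm.\<close>

lemma square_root_mahalanobis:
  fixes L S :: "real ^ 'n ^ 'n"
  assumes "spd S" "L ** transpose L = S"
  shows "(L *v x) \<bullet> (matrix_inv S *v (L *v x)) = (norm x)\<^sup>2"
proof -
  have "L ** (transpose L ** matrix_inv S) = mat 1"
    by (metis assms matrix_inv_cancel(1) matrix_mul_assoc spd_invertible)
  then have "transpose L ** matrix_inv S ** L = mat 1"
    using matrix_left_right_inverse by blast
  then have "transpose L *v (matrix_inv S *v (L *v x)) = x"
    by (metis matrix_vector_mul_assoc matrix_vector_mul_lid)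
  then show ?thesis
    by (metis inner_matrix_vector_transpose power2_norm_eq_inner)
qed

lemma square_root_through_vectors:
  fixes S :: "real ^ 'n ^ 'n"
  assumes "spd S" "y \<bullet> (matrix_inv S *v y) = (norm \<xi>)\<^sup>2"
  obtains L :: "real ^ 'n ^ 'n" where "L ** transpose L = S" "L *v \<xi> = y"
proof -
  obtain R :: "real ^ 'n ^ 'n" where R: "R ** transpose R = S"
    using spd_square_root_exists[OF assms(1)] .
  \<comment> \<open>This is the inverse of \<open>R\<close> applied to \<open>y\<close>, since
    \<open>R ** transpose R = S\<close> makes \<open>transpose R ** matrix_inv S\<close> that
    inverse.\<close>
  define \<eta> where "\<eta> = transpose R *v (matrix_inv S *v y)"
  have y: "R *v \<eta> = y"
    unfolding \<eta>_def
    by (simp add: matrix_vector_mul_assoc matrix_mul_assoc R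
        matrix_inv_cancel[OF spd_invertible[OF assms(1)]] del: transpose_matrix_vector)
  have "(norm \<eta>)\<^sup>2 = (norm \<xi>)\<^sup>2"
    using square_root_mahalanobis[OF assms(1) R, of \<eta>] assms(2) by (simp add: y)
  then have "norm \<xi> = norm \<eta>"
    by simp
  then obtain f where f: "orthogonal_transformation f" "f \<xi> = \<eta>"
    by (rule orthogonal_transformation_exists)
  let ?Q = "matrix f"
  have Q: "?Q ** transpose ?Q = mat 1" "?Q *v \<xi> = \<eta>"
    using f by (auto simp: orthogonal_transformation_matrix orthogonal_matrix_def matrix_works)
  show ?thesis
  proof (rule that[of "R ** ?Q"])
    show "R ** ?Q ** transpose (R ** ?Q) = S"
      by (metis Q(1) R matrix_mul_assoc matrix_mul_rid matrix_transpose_mul)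
    show "R ** ?Q *v \<xi> = y"
      by (simp add: Q(2) y flip: matrix_vector_mul_assoc)
  qed
qed

text \<open>Gives the product rule for \<open>P s *v Y s\<close>; in finite dimension bilinearity
  already implies boundedness.\<close>

lemma bounded_bilinear_matrix_vector_mult:
  "bounded_bilinear ((*v) :: real ^ 'n ^ 'm \<Rightarrow> real ^ 'n \<Rightarrow> real ^ 'm)"
proof -
  have "linear (\<lambda>M :: real ^ 'n ^ 'm. M *v x)" for x
    by (rule linearI) (simp_all add: matrix_vector_mult_add_rdistrib scaleR_matrix_vector_assoc)
  then show ?thesis
    by (simp add: bilinear_def flip: bilinear_conv_bounded_bilinear)
qed

text \<open>Because \<open>S\<close> inverts \<open>P t\<close>, each of the two terms containing
  the derivative of \<open>Y\<close> equals minus one half of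
  \<open>Y t \<bullet> (H *v Y t)\<close>. Together they cancel the term coming from the derivative
  \<open>H\<close> of \<open>P\<close>, which explains the factor 1/2 in the drift.\<close>

lemma mahalanobis_norm_derivative_zero:
  fixes P :: "real \<Rightarrow> real ^ 'n ^ 'n"
  assumes Y: "(Y has_vector_derivative ((- 1 / 2) *\<^sub>R (S ** H)) *v Y t) (at t within T)"
    and P: "(P has_vector_derivative H) (at t within T)"
    and sym: "transpose (P t) = P t" and inv: "S ** P t = mat 1" "transpose S = S"
  shows "((\<lambda>s. Y s \<bullet> (P s *v Y s)) has_vector_derivative 0) (at t within T)"
proof -
  let ?y = "Y t" and ?Y' = "((- 1 / 2) *\<^sub>R (S ** H)) *v Y t"
  have "((\<lambda>s. Y s \<bullet> (P s *v Y s)) has_vector_derivative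
      ?y \<bullet> (P t *v ?Y' + H *v ?y) + ?Y' \<bullet> (P t *v ?y)) (at t within T)"
    by (intro bounded_bilinear.has_vector_derivative[OF bounded_bilinear_inner]
        bounded_bilinear.has_vector_derivative[OF bounded_bilinear_matrix_vector_mult] Y P)
  moreover have "?Y' \<bullet> (P t *v ?y) = - (?y \<bullet> (H *v ?y)) / 2"
  proof -
    have "(S *v (H *v ?y)) \<bullet> (P t *v ?y) = (H *v ?y) \<bullet> (S *v (P t *v ?y))"
      using inner_matrix_vector_transpose inv(2) by metis
    also have "\<dots> = ?y \<bullet> (H *v ?y)"
      by (simp add: matrix_vector_mul_assoc inv inner_commute)
    finally have "(S ** H *v ?y) \<bullet> (P t *v ?y) = ?y \<bullet> (H *v ?y)"
      by (simp add: matrix_vector_mul_assoc)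
    then show ?thesis
      unfolding scaleR_matrix_vector_assoc[symmetric] inner_scaleR_left by simp
  qed
  moreover have "?y \<bullet> (P t *v ?Y') = ?Y' \<bullet> (P t *v ?y)"
    using inner_matrix_vector_transpose[of "P t" ?y ?Y'] sym by (simp add: inner_commute)
  ultimately show ?thesis
    by (simp add: inner_add_right)
qed

theorem theorem10:
  fixes p :: nat
    and T :: "real set"
    and N :: "'z measure" and z :: 'z
    and prior :: "real ^ 'n \<Rightarrow> real"
    and lik :: "real ^ 'n \<Rightarrow> 'z \<Rightarrow> real"
    and q V :: "real \<Rightarrow> real ^ 'n \<Rightarrow> real"
    and \<mu> b X :: "real \<Rightarrow> real ^ 'n"
    and \<Sigma> A :: "real \<Rightarrow> real ^ 'n ^ 'n"
  assumes p: "1 \<le> p"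
    and T: "is_interval T" "0 \<in> T"
    and N: "sigma_finite_measure N" "z \<in> space N"
    and prior: "probability_density lborel prior"
    and lik: "\<And>x. probability_density N (lik x)"
    and joint: "probability_density (lborel \<Otimes>\<^sub>M N) (\<lambda>(x, y). lik x y * prior x)"
    and joint_pos: "\<And>x. 0 < lik x z * prior x"
    and q: "\<And>t. t \<in> T \<Longrightarrow> gaussian_mixture_with_component (\<mu> t) (\<Sigma> t) (q t)"
    and V: "\<And>t x. t \<in> T \<Longrightarrow> V t x = ln (q t x) - ln (lik x z * prior x)"
    and V_C2: "\<And>t. t \<in> T \<Longrightarrow> twice_continuously_differentiable (V t)"
    and grad_finite: "\<And>t. t \<in> T \<Longrightarrow> integrable (gaussian (\<mu> t) (\<Sigma> t)) (gradient (V t))"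
    and hess_finite: "\<And>t. t \<in> T \<Longrightarrow> integrable (gaussian (\<mu> t) (\<Sigma> t)) (hessian (V t))"
    and grad_cont: "continuous_on T (\<lambda>t. \<integral>x. gradient (V t) x \<partial>gaussian (\<mu> t) (\<Sigma> t))"
    and hess_cont: "continuous_on T (\<lambda>t. \<integral>x. hessian (V t) x \<partial>gaussian (\<mu> t) (\<Sigma> t))"
    and \<Sigma>_spd: "\<And>t. t \<in> T \<Longrightarrow> spd (\<Sigma> t)"
    and \<mu>_flow: "\<And>t. t \<in> T \<Longrightarrow>
      (\<mu> has_vector_derivative
        - (\<Sigma> t *v (\<integral>x. gradient (V t) x \<partial>gaussian (\<mu> t) (\<Sigma> t)))) (at t within T)"
    and \<Sigma>_flow: "\<And>t. t \<in> T \<Longrightarrow>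
      ((\<lambda>s. matrix_inv (\<Sigma> s)) has_vector_derivative
        (\<integral>x. hessian (V t) x \<partial>gaussian (\<mu> t) (\<Sigma> t))) (at t within T)"
    and A: "\<And>t. t \<in> T \<Longrightarrow>
      A t = (- 1 / 2) *\<^sub>R (\<Sigma> t ** (\<integral>x. hessian (V t) x \<partial>gaussian (\<mu> t) (\<Sigma> t)))"
    and b: "\<And>t. t \<in> T \<Longrightarrow>
      b t = - (\<Sigma> t *v (\<integral>x. gradient (V t) x \<partial>gaussian (\<mu> t) (\<Sigma> t))) - A t *v \<mu> t"
    and X_0: "gauss_hermite_particle p (\<mu> 0) (\<Sigma> 0) (X 0)"
    and X_flow: "\<And>t. t \<in> T \<Longrightarrow> (X has_vector_derivative A t *v X t + b t) (at t within T)"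
  shows "\<forall>t\<in>T. gauss_hermite_particle p (\<mu> t) (\<Sigma> t) (X t)"
proof
  fix t
  assume t: "t \<in> T"
  define Y where "Y = (\<lambda>s. X s - \<mu> s)"
  define H where "H = (\<lambda>s. \<integral>x. hessian (V s) x \<partial>gaussian (\<mu> s) (\<Sigma> s))"
  define m where "m = (\<lambda>s. Y s \<bullet> (matrix_inv (\<Sigma> s) *v Y s))"
  \<comment> \<open>By the choice of \<open>b\<close>, the mean solves the particle equation as
    well: its velocity is \<open>A s *v \<mu> s + b s\<close>. The inhomogeneous term cancels in the
    difference.\<close>
  have Y': "(Y has_vector_derivative A s *v Y s) (at s within T)" if "s \<in> T" for s
    using has_vector_derivative_diff[OF X_flow[OF that] \<mu>_flow[OF that]]
    by (simp add: Y_def b[OF that] matrix_vector_mult_diff_distrib)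
  have "(m has_vector_derivative 0) (at s within T)" if "s \<in> T" for s
    unfolding m_def
  proof (rule mahalanobis_norm_derivative_zero)
    show "(Y has_vector_derivative ((- 1 / 2) *\<^sub>R (\<Sigma> s ** H s)) *v Y s) (at s within T)"
      using Y'[OF that] by (simp add: A[OF that] H_def)
    show "((\<lambda>s. matrix_inv (\<Sigma> s)) has_vector_derivative H s) (at s within T)"
      using \<Sigma>_flow[OF that] by (simp add: H_def)
    show "transpose (matrix_inv (\<Sigma> s)) = matrix_inv (\<Sigma> s)"
      using spd_matrix_inv[OF \<Sigma>_spd[OF that]] by (simp add: spd_def)
    show "\<Sigma> s ** matrix_inv (\<Sigma> s) = mat 1"
      by (rule matrix_inv_cancel[OF spd_invertible[OF \<Sigma>_spd[OF that]]])
    show "transpose (\<Sigma> s) = \<Sigma> s"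
      using \<Sigma>_spd[OF that] by (simp add: spd_def)
  qed
  \<comment> \<open>An interval is convex, so a zero derivative within \<open>T\<close> makes
    \<open>m\<close> constant on \<open>T\<close>, at times before 0 as well as after.\<close>
  then have "m t = m 0"
    using has_vector_derivative_zero_constant[of T m] T t by (metis is_interval_convex)
  obtain L :: "real ^ 'n ^ 'n" and \<xi> where L: "L ** transpose L = \<Sigma> 0" and \<xi>: "\<xi> \<in> std_gauss_hermite_particles p"
    and "X 0 = L *v \<xi> + \<mu> 0"
    using X_0 unfolding gauss_hermite_particle_def by blast
  then have "m 0 = (norm \<xi>)\<^sup>2"
    using square_root_mahalanobis[OF \<Sigma>_spd[OF T(2)] L] by (simp add: m_def Y_def)
  with \<open>m t = m 0\<close> have "Y t \<bullet> (matrix_inv (\<Sigma> t) *v Y t) = (norm \<xi>)\<^sup>2"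
    by (simp add: m_def)
  then obtain K :: "real ^ 'n ^ 'n" where "K ** transpose K = \<Sigma> t" "K *v \<xi> = Y t"
    using square_root_through_vectors[OF \<Sigma>_spd[OF t]] by blast
  with \<xi> show "gauss_hermite_particle p (\<mu> t) (\<Sigma> t) (X t)"
    unfolding gauss_hermite_particle_def Y_def by (metis diff_add_cancel)
qed

end
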